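(* For any finite sequence of channel actions $\sigma$ and any channel contents $x\in\Sigma^*$, the iteration number satisfies $L(\sigma,x)\le |x|\,(|\mathrm{rea}(\sigma)|+1)$.
   Context: Channel actions over a finite alphabet $\Sigma$ are $!w$ and $?w$ with $w\in\Sigma^*$. $\mathrm{rea}(?w)=w$, $\mathrm{rea}(!w)=\epsilon$, extended to sequences by concatenation. Lossy semantics: $x\xrightarrow{!w}y$ iff $y\sqsubseteq xw$, $x\xrightarrow{?w}y$ iff $wy\sqsubseteq x$ ($\sqsubseteq$ the scattered subword ordering), extended to sequences by composition. $\uparrow x=\{y : x\sqsubseteq y\}$. For a sequence $\sigma$, $\mathrm{pr}[\sigma](x)$ is the unique word $y$ with $\{z : \exists x'\in\uparrow x,\ z\xrightarrow{\sigma}x'\}=\uparrow y$ (it always exists; $\mathrm{pr}[\epsilon](x)=x$). The iteration number $L(\sigma,x)$ is the smallest integer $L$ such that there exists $\ell\le L$ with $\mathrm{pr}[\sigma^\ell](x)\sqsubseteq\mathrm{pr}[\sigma^{L+1}](x)$. *)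

theory Defs
  imports Main "HOL-Library.Sublist"
begin

datatype 'a act = Send "'a list" | Recv "'a list"

fun rea_act :: "'a act \<Rightarrow> 'a list" where
  "rea_act (Recv w) = w"
| "rea_act (Send w) = []"

definition rea :: "'a act list \<Rightarrow> 'a list" where
  "rea \<sigma> = concat (map rea_act \<sigma>)"

text \<open>Lossy semantics. The subword ordering is \<^const>\<open>subseq\<close> (scattered, not contiguous, subwords).\<close>

fun step :: "'a act \<Rightarrow> 'a list \<Rightarrow> 'a list \<Rightarrow> bool" where
  "step (Send w) x y \<longleftrightarrow> subseq y (x @ w)"
| "step (Recv w) x y \<longleftrightarrow> subseq (w @ y) x"

fun steps :: "'a act list \<Rightarrow> 'a list \<Rightarrow> 'a list \<Rightarrow> bool" where
  "steps [] x z \<longleftrightarrow> x = z"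
| "steps (a # \<sigma>) x z \<longleftrightarrow> (\<exists>y. step a x y \<and> steps \<sigma> y z)"

definition up :: "'a list \<Rightarrow> 'a list set" where
  "up x = {y. subseq x y}"

definition pr :: "'a act list \<Rightarrow> 'a list \<Rightarrow> 'a list" where
  "pr \<sigma> x = (THE y. {z. \<exists>x'\<in>up x. steps \<sigma> z x'} = up y)"

definition seq_power :: "'a act list \<Rightarrow> nat \<Rightarrow> 'a act list" where
  "seq_power \<sigma> n = concat (replicate n \<sigma>)"

text \<open>Over a finite alphabet Higman's lemma guarantees that such a number exists.\<close>

definition iteration_number :: "'a act list \<Rightarrow> 'a list \<Rightarrow> nat" where
  "iteration_number \<sigma> x =
     (LEAST L. \<exists>l\<le>L. subseq (pr (seq_power \<sigma> l) x) (pr (seq_power \<sigma> (L + 1)) x))"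

end

theory Submission
  imports Defs
begin

text \<open>The word \<open>pr[\<sigma>](x)\<close> is always a prefix of \<open>rea(\<sigma>) x\<close>: a receive adds a prefix, a send
  erases a suffix. Write \<open>r = rea(\<sigma>)\<close> and let \<open>y\<^sub>n = pr[\<sigma>^n](x)\<close>, a prefix of \<open>r y\<^sub>n\<^sub>-\<^sub>1\<close> for
  \<open>n > 0\<close>. Suppose \<open>y\<^sub>n\<close> is never a subword of its successor. While a part of \<open>x\<close> is left, we have
  \<open>y\<^sub>n = r\<^sup>n u\<close> with \<open>u\<close> a prefix of \<open>x\<close>, and each iteration must shorten \<open>u\<close>, so after \<open>|x|\<close>
  iterations \<open>x\<close> has been consumed. From then on all \<open>y\<^sub>n\<close> are prefixes of the periodic word
  \<open>r r r \<dots>\<close>, hence comparable, so their lengths must strictly decrease from at most \<open>|x| |r|\<close>.\<close>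

lemma up_inject: "up x = up y \<longleftrightarrow> x = y"
  by (metis mem_Collect_eq subseq_order.antisym subseq_order.refl up_def)

text \<open>The set in the definition of \<open>pr\<close>, with an arbitrary target in place of
  \<open>up x\<close>, so that preimages compose along concatenation.\<close>

definition preimage :: "'a act list \<Rightarrow> 'a list set \<Rightarrow> 'a list set" where
  "preimage \<sigma> X = {z. \<exists>x'\<in>X. steps \<sigma> z x'}"

lemma preimage_Nil: "preimage [] X = X"
  by (auto simp: preimage_def)

lemma preimage_Cons: "preimage (a # \<sigma>) X = preimage [a] (preimage \<sigma> X)"
  by (auto simp: preimage_def)

lemma preimage_append: "preimage (\<sigma> @ \<tau>) X = preimage \<sigma> (preimage \<tau> X)"
proof (induction \<sigma>)
  case Nil
  show ?case by (simp add: preimage_Nil)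
next
  case (Cons a \<sigma>)
  then show ?case
    by (simp add: preimage_Cons[of a "\<sigma> @ \<tau>"] preimage_Cons[of a \<sigma>])
qed

lemma preimage_Recv_up: "preimage [Recv w] (up x) = up (w @ x)"
proof -
  have "(\<exists>y. subseq x y \<and> subseq (w @ y) z) \<longleftrightarrow> subseq (w @ x) z" for z
    by (meson list_emb_append_mono subseq_order.refl subseq_order.trans)
  then show ?thesis by (auto simp: preimage_def up_def)
qed

lemma preimage_Send_up: "preimage [Send w] (up x) = {z. subseq x (z @ w)}"
  by (auto simp: preimage_def up_def intro: subseq_order.trans)

text \<open>Matching greedily from the right, \<open>w\<close> absorbs the longest suffix of
  \<open>x\<close> that embeds in it; the rest of \<open>x\<close> must embed in
  \<open>z\<close>.\<close>

lemma subseq_append_residual: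
  obtains y where "prefix y x" "\<And>z. subseq x (z @ w) \<longleftrightarrow> subseq y z"
proof
  define n where "n = (LEAST n. subseq (drop n x) w)"
  have n: "subseq (drop n x) w"
    unfolding n_def by (rule LeastI[of _ "length x"]) simp
  show "prefix (take n x) x" by (rule take_is_prefix)
  fix z
  show "subseq x (z @ w) \<longleftrightarrow> subseq (take n x) z"
  proof
    assume "subseq x (z @ w)"
    then obtain x1 x2 where x: "x = x1 @ x2" "subseq x1 z" "subseq x2 w"
      by (auto simp: subseq_append_iff)
    then have "n \<le> length x1" unfolding n_def by (intro Least_le) simp
    with x have "prefix (take n x) x1" by (simp add: take_is_prefix)
    with x show "subseq (take n x) z"
      using prefix_imp_subseq subseq_order.trans by blast
  next
    assume "subseq (take n x) z"
    with n show "subseq x (z @ w)"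
      using list_emb_append_mono by (metis append_take_drop_id)
  qed
qed

text \<open>Together with \<open>up_inject\<close>, this makes the definite description in
  \<open>pr\<close> denote. The first action is undone last, so it acts on the cone already obtained
  for the tail.\<close>

lemma preimage_up_exists: "\<exists>y. prefix y (rea \<sigma> @ x) \<and> preimage \<sigma> (up x) = up y"
proof (induction \<sigma>)
  case Nil
  show ?case by (auto simp: preimage_Nil rea_def)
next
  case (Cons a \<sigma>)
  then obtain y where y: "prefix y (rea \<sigma> @ x)" "preimage \<sigma> (up x) = up y" by blast
  have eq: "preimage (a # \<sigma>) (up x) = preimage [a] (up y)"
    by (subst preimage_Cons) (simp add: y)
  show ?case
  proof (cases a)
    case (Send w)
    obtain y' where y': "prefix y' y" "\<And>z. subseq y (z @ w) \<longleftrightarrow> subseq y' z"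
      using subseq_append_residual[of y w] by blast
    then have "preimage [a] (up y) = up y'"
      unfolding Send preimage_Send_up by (simp add: up_def)
    moreover have "prefix y' (rea (a # \<sigma>) @ x)"
      using prefix_order.trans[OF y'(1) y(1)] by (simp add: rea_def Send)
    ultimately show ?thesis using eq by auto
  next
    case (Recv w)
    with y have "prefix (w @ y) (rea (a # \<sigma>) @ x)" by (simp add: rea_def)
    with eq Recv show ?thesis by (auto simp: preimage_Recv_up)
  qed
qed

lemma pr_eqI: "preimage \<sigma> (up x) = up y \<Longrightarrow> pr \<sigma> x = y"
  unfolding pr_def preimage_def by (rule the_equality) (auto simp: up_inject)

lemma preimage_up: "preimage \<sigma> (up x) = up (pr \<sigma> x)"
  using preimage_up_exists pr_eqI by metis

lemma pr_prefix: "prefix (pr \<sigma> x) (rea \<sigma> @ x)"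
  using preimage_up_exists pr_eqI by metis

text \<open>Going backwards, the later actions \<open>\<tau>\<close> are undone first.\<close>

lemma pr_append: "pr (\<sigma> @ \<tau>) x = pr \<sigma> (pr \<tau> x)"
  by (rule pr_eqI) (simp only: preimage_append preimage_up[of \<tau>] preimage_up[of \<sigma>])

lemma pr_seq_power_0: "pr (seq_power \<sigma> 0) x = x"
  by (rule pr_eqI) (simp add: seq_power_def preimage_Nil)

lemma pr_seq_power_Suc: "pr (seq_power \<sigma> (Suc n)) x = pr \<sigma> (pr (seq_power \<sigma> n) x)"
  by (simp add: seq_power_def pr_append)

lemma strict_prefix_append_take_Suc:
  assumes "prefix y (w @ take (Suc k) x)" "y \<noteq> w @ take (Suc k) x" "k < length x"
  shows "prefix y (w @ take k x)"
  using assms by (simp add: take_Suc_conv_app_nth flip: append_assoc)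

abbreviation word_power :: "'a list \<Rightarrow> nat \<Rightarrow> 'a list" where
  "word_power r n \<equiv> concat (replicate n r)"

lemma word_power_Suc_right: "word_power r (Suc n) = word_power r n @ r"
  by (metis append.right_neutral concat.simps concat_append replicate_Suc replicate_append_same)

text \<open>Channel actions are abstracted away: the prefix property of successive iterates is all
  that the counting argument needs.\<close>

lemma growing_queue_subseq_Suc:
  fixes y :: "nat \<Rightarrow> 'a list"
  assumes step: "\<And>n. prefix (y (Suc n)) (r @ y n)"
  shows "\<exists>l \<le> length (y 0) * (length r + 1). subseq (y l) (y (Suc l))"
proof (rule ccontr)
  assume "\<not> ?thesis"
  then have no: "\<not> subseq (y l) (y (Suc l))" if "l \<le> length (y 0) * (length r + 1)" for l
    using that by blast
  have step': "prefix (y (Suc n)) (r @ v)" if "prefix (y n) v" for n v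
    using step[of n] that by (meson prefix_order.trans same_prefix_prefix)
  have consume: "prefix (y n) (word_power r n @ take (length (y 0) - n) (y 0))"
    if "n \<le> length (y 0)" for n
    using that
  proof (induction n)
    case 0
    show ?case by simp
  next
    case (Suc n)
    define k where "k = length (y 0) - Suc n"
    have k: "length (y 0) - n = Suc k" "k < length (y 0)"
      using Suc.prems by (auto simp: k_def)
    have IH: "prefix (y n) (word_power r n @ take (Suc k) (y 0))"
      using Suc k by simp
    have "prefix (y (Suc n)) (word_power r (Suc n) @ take k (y 0))"
    proof (cases "y n = word_power r n @ take (Suc k) (y 0)")
      case True
      \<comment> \<open>If \<open>y (Suc n)\<close> were all of \<open>r @ y n\<close>, it would
        contain \<open>y n\<close> as a suffix; so at least the last letter, which belongs to
        \<open>y 0\<close>, is lost.\<close>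
      have "\<not> subseq (y n) (y (Suc n))" using Suc.prems by (intro no) simp
      with True have "y (Suc n) \<noteq> r @ y n" by auto
      with True show ?thesis
        using strict_prefix_append_take_Suc[of "y (Suc n)" "word_power r (Suc n)" k "y 0"]
          step[of n] k by simp
    next
      case False
      \<comment> \<open>The letter was already lost before this iteration, and prepending
        \<open>r\<close> does not bring it back.\<close>
      have "prefix (y n) (word_power r n @ take k (y 0))"
        using strict_prefix_append_take_Suc[OF IH False k(2)] .
      from step'[OF this] show ?thesis by simp
    qed
    then show ?case by (simp add: k_def)
  qed
  have periodic: "prefix (y (length (y 0) + m)) (word_power r (length (y 0) + m))" for m
  proof (induction m)
    case 0
    show ?case using consume[of "length (y 0)"] by simp
  next
    case (Suc m)
    from step'[OF this] show ?case by simp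
  qed
  \<comment> \<open>The range of \<open>m\<close> ends at the first value for which the inequality
    is absurd; the iteration leading there starts at the last index covered by
    \<open>no\<close>.\<close>
  have shrink: "length (y (length (y 0) + m)) + m \<le> length (y 0) * length r"
    if "m \<le> length (y 0) * length r + 1" for m
    using that
  proof (induction m)
    case 0
    show ?case
      using prefix_length_le[OF periodic[of 0]] by (simp add: length_concat sum_list_replicate)
  next
    case (Suc m)
    let ?n = "length (y 0) + m"
    \<comment> \<open>Adding the extra \<open>r\<close> on the right makes both iterates prefixes of
      one word, so the one that does not embed in the other is the longer.\<close>
    have "prefix (y ?n) (word_power r (Suc ?n))"
      unfolding word_power_Suc_right using periodic[of m] by (rule prefix_prefix)
    moreover have "prefix (y (Suc ?n)) (word_power r (Suc ?n))"
      using periodic[of "Suc m"] by simp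
    moreover have "\<not> subseq (y ?n) (y (Suc ?n))"
      using Suc.prems by (intro no) simp
    ultimately have "length (y (Suc ?n)) < length (y ?n)"
      by (meson not_less prefix_imp_subseq prefix_length_prefix)
    with Suc show ?case by simp
  qed
  show False using shrink[of "length (y 0) * length r + 1"] by simp
qed

lemma subseq_pr_seq_power_Suc:
  "\<exists>l \<le> length x * (length (rea \<sigma>) + 1).
     subseq (pr (seq_power \<sigma> l) x) (pr (seq_power \<sigma> (Suc l)) x)"
  using growing_queue_subseq_Suc[of "\<lambda>n. pr (seq_power \<sigma> n) x" "rea \<sigma>"]
  by (simp add: pr_seq_power_0 pr_seq_power_Suc pr_prefix)

theorem theorem10:
  fixes \<sigma> :: "'a::finite act list" and x :: "'a list"
  shows "iteration_number \<sigma> x \<le> length x * (length (rea \<sigma>) + 1)"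
proof -
  obtain l where l: "l \<le> length x * (length (rea \<sigma>) + 1)"
      "subseq (pr (seq_power \<sigma> l) x) (pr (seq_power \<sigma> (Suc l)) x)"
    using subseq_pr_seq_power_Suc by blast
  \<comment> \<open>The witness is \<open>L = l\<close>, with \<open>l\<close> itself as the inner
    index.\<close>
  from l(2) have "iteration_number \<sigma> x \<le> l"
    unfolding iteration_number_def by (intro Least_le) auto
  with l(1) show ?thesis by simp
qed

end
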